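(* For a topological space $X$, the following statements are equivalent: (1) $X$ is $H^*$-normal. (2) For every pair of open sets $Q$ and $R$ of $X$ with $Q\cup R=X$, there exist $H^*$-closed sets $D\subseteq Q$ and $E\subseteq R$ such that $D\cup E=X$. (3) For every closed set $J\subseteq X$ and every open set $K\subseteq X$ with $J\subseteq K$, there exists an $H^*$-open set $Q$ such that $J\subseteq Q\subseteq H^*\text{-}\operatorname{cl}(Q)\subseteq K$.
   Context: No separation axioms are assumed. Let $X$ be a topological space and $A\subseteq X$. $A$ is semi-closed if $\operatorname{int}(\operatorname{cl}(A))\subseteq A$, and semi-open if its complement is semi-closed; $s\text{-}\operatorname{cl}(A)$ is the intersection of all semi-closed sets containing $A$. $A$ is $w$-closed if $\operatorname{cl}(A)\subseteq U$ whenever $A\subseteq U$ and $U$ is semi-open; $w$-open means complement of $w$-closed. $A$ is $h$-closed if $s\text{-}\operatorname{cl}(A)\subseteq U$ whenever $A\subseteq U$ and $U$ is $w$-open; $h\text{-}\operatorname{cl}(A)$ is the intersection of all $h$-closed sets containing $A$. A set $V$ is an $\alpha^*$-set if $\operatorname{int}(\operatorname{cl}(\operatorname{int}(V)))=\operatorname{int}(V)$; a $C$-set is a set of the form $U\cap V$ with $U$ open and $V$ an $\alpha^*$-set. $A$ is $hCg$-closed if $h\text{-}\operatorname{cl}(A)\subseteq U$ whenever $A\subseteq U$ and $U$ is a $C$-set; $hCg$-open means complement of $hCg$-closed. $A$ is $H^*$-closed if $h\text{-}\operatorname{cl}(A)\subseteq U$ whenever $A\subseteq U$ and $U$ is $hCg$-open;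 $H^*$-open means complement of $H^*$-closed. $H^*\text{-}\operatorname{cl}(A)$ is the intersection of all $H^*$-closed sets containing $A$. $X$ is $H^*$-normal if for any pair of disjoint closed sets $A,B\subseteq X$ there exist disjoint $H^*$-open sets $U,V$ with $A\subseteq U$ and $B\subseteq V$. *)

theory Defs
  imports "HOL-Analysis.Analysis"
begin

(* Every class of sets below consists of subsets of the carrier "topspace X", and complements are
   taken in the carrier. The carrier is itself semi-closed, h-closed and H*-closed, so for
   A \<subseteq> topspace X the families whose intersections define the closures are nonempty and the
   closures lie in the carrier; the closures are only ever applied to such A. *)

definition semi_closed :: "'a topology \<Rightarrow> 'a set \<Rightarrow> bool" where
  "semi_closed X A \<longleftrightarrow> A \<subseteq> topspace X \<and> X interior_of (X closure_of A) \<subseteq> A"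

definition semi_open :: "'a topology \<Rightarrow> 'a set \<Rightarrow> bool" where
  "semi_open X A \<longleftrightarrow> A \<subseteq> topspace X \<and> semi_closed X (topspace X - A)"

definition s_cl :: "'a topology \<Rightarrow> 'a set \<Rightarrow> 'a set" where
  "s_cl X A = \<Inter>{F. semi_closed X F \<and> A \<subseteq> F}"

definition w_closed :: "'a topology \<Rightarrow> 'a set \<Rightarrow> bool" where
  "w_closed X A \<longleftrightarrow> A \<subseteq> topspace X \<and>
     (\<forall>U. semi_open X U \<and> A \<subseteq> U \<longrightarrow> X closure_of A \<subseteq> U)"

definition w_open :: "'a topology \<Rightarrow> 'a set \<Rightarrow> bool" where
  "w_open X A \<longleftrightarrow> A \<subseteq> topspace X \<and> w_closed X (topspace X - A)"

definition h_closed :: "'a topology \<Rightarrow> 'a set \<Rightarrow> bool" where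
  "h_closed X A \<longleftrightarrow> A \<subseteq> topspace X \<and>
     (\<forall>U. w_open X U \<and> A \<subseteq> U \<longrightarrow> s_cl X A \<subseteq> U)"

definition h_cl :: "'a topology \<Rightarrow> 'a set \<Rightarrow> 'a set" where
  "h_cl X A = \<Inter>{F. h_closed X F \<and> A \<subseteq> F}"

definition alpha_star_set :: "'a topology \<Rightarrow> 'a set \<Rightarrow> bool" where
  "alpha_star_set X V \<longleftrightarrow> V \<subseteq> topspace X \<and>
     X interior_of (X closure_of (X interior_of V)) = X interior_of V"

definition C_set :: "'a topology \<Rightarrow> 'a set \<Rightarrow> bool" where
  "C_set X A \<longleftrightarrow> (\<exists>U V. openin X U \<and> alpha_star_set X V \<and> A = U \<inter> V)"

definition hCg_closed :: "'a topology \<Rightarrow> 'a set \<Rightarrow> bool" where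
  "hCg_closed X A \<longleftrightarrow> A \<subseteq> topspace X \<and>
     (\<forall>U. C_set X U \<and> A \<subseteq> U \<longrightarrow> h_cl X A \<subseteq> U)"

definition hCg_open :: "'a topology \<Rightarrow> 'a set \<Rightarrow> bool" where
  "hCg_open X A \<longleftrightarrow> A \<subseteq> topspace X \<and> hCg_closed X (topspace X - A)"

definition Hstar_closed :: "'a topology \<Rightarrow> 'a set \<Rightarrow> bool" where
  "Hstar_closed X A \<longleftrightarrow> A \<subseteq> topspace X \<and>
     (\<forall>U. hCg_open X U \<and> A \<subseteq> U \<longrightarrow> h_cl X A \<subseteq> U)"

definition Hstar_open :: "'a topology \<Rightarrow> 'a set \<Rightarrow> bool" where
  "Hstar_open X A \<longleftrightarrow> A \<subseteq> topspace X \<and> Hstar_closed X (topspace X - A)"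

definition Hstar_cl :: "'a topology \<Rightarrow> 'a set \<Rightarrow> 'a set" where
  "Hstar_cl X A = \<Inter>{F. Hstar_closed X F \<and> A \<subseteq> F}"

definition Hstar_normal :: "'a topology \<Rightarrow> bool" where
  "Hstar_normal X \<longleftrightarrow>
     (\<forall>A B. closedin X A \<and> closedin X B \<and> disjnt A B \<longrightarrow>
        (\<exists>U V. Hstar_open X U \<and> Hstar_open X V \<and> disjnt U V \<and> A \<subseteq> U \<and> B \<subseteq> V))"

end

theory Submission
  imports Defs
begin

text \<open>
  The only delicate implication is from (3) to (1): it needs the complement of the \<open>H*\<close>-closure to
  be \<open>H*\<close>-open, i.e. \<open>H*\<close>-closed sets must be stable under intersections. This is not formal, since
  it fails in general for classes defined by "the closure lies in every special neighbourhood". It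
  holds here because a set \<open>A\<close> is \<open>H*\<close>-closed exactly when it contains all closed points of
  \<open>int (cl A)\<close>, a condition stable under intersections. The reason is a dichotomy: every singleton
  \<open>{p}\<close> is either nowhere dense, hence semi-closed, or satisfies \<open>p \<in> int (cl {p})\<close>. If \<open>y\<close> lies in
  \<open>h-cl A\<close> but not in \<open>A\<close>, then \<open>cl {y}\<close> has no nowhere dense point besides \<open>y\<close>, so either \<open>y\<close> is
  closed, or \<open>cl {y}\<close> is clopen and indiscrete; in the second case \<open>cl {y}\<close> meets \<open>A\<close>, and no
  \<open>hCg\<close>-closed set containing \<open>y\<close> can avoid the points of \<open>cl {y}\<close>.
\<close>

section \<open>Semi-closed sets, the dichotomy for points, and bounds on \<open>h_cl\<close>\<close>

lemma semi_closed_singleton_or_interior_closure: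
  assumes "p \<in> topspace X"
  shows "semi_closed X {p} \<or> p \<in> X interior_of (X closure_of {p})"
proof (cases "X interior_of (X closure_of {p}) = {}")
  case True
  then show ?thesis
    using assms by (simp add: semi_closed_def)
next
  case False
  then obtain q where "q \<in> X interior_of (X closure_of {p})"
    by blast
  moreover have "q \<in> X closure_of {p}"
    using calculation interior_of_subset by fastforce
  \<comment> \<open>An open set that meets the closure of \<open>{p}\<close> meets
    \<open>{p}\<close>, so it contains \<open>p\<close>.\<close>
  ultimately show ?thesis
    using openin_interior_of[of X "X closure_of {p}"] by (auto simp: in_closure_of)
qed

lemma interior_closure_subset_semi_closed:
  assumes "semi_closed X F" "A \<subseteq> F"
  shows "X interior_of (X closure_of A) \<subseteq> F"
  using assms closure_of_mono interior_of_mono unfolding semi_closed_def by (metis subset_trans)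

lemma interior_closure_subset_s_cl: "X interior_of (X closure_of A) \<subseteq> s_cl X A"
  unfolding s_cl_def using interior_closure_subset_semi_closed by blast

text \<open>The added open set lies in the closure of \<open>A\<close>, so adding it changes neither
  the closure nor its interior. The union is the classical formula for the semi-closure.\<close>

lemma semi_closed_Un_interior_closure:
  assumes "A \<subseteq> topspace X"
  shows "semi_closed X (A \<union> X interior_of (X closure_of A))"
proof -
  have "X closure_of (X interior_of (X closure_of A)) \<subseteq> X closure_of A"
    by (simp add: closure_of_minimal interior_of_subset)
  then have "X closure_of (A \<union> X interior_of (X closure_of A)) = X closure_of A"
    by (auto simp: closure_of_Un)
  then show ?thesis
    using assms interior_of_subset_topspace[of X "X closure_of A"] by (auto simp: semi_closed_def)
qed

lemma semi_closed_imp_h_closed: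
  assumes "semi_closed X A"
  shows "h_closed X A"
  using assms unfolding h_closed_def semi_closed_def s_cl_def by blast

lemma closedin_imp_semi_closed:
  assumes "closedin X A"
  shows "semi_closed X A"
  using assms by (simp add: semi_closed_def closedin_subset closure_of_closedin interior_of_subset)

lemma h_cl_mono: "A \<subseteq> B \<Longrightarrow> h_cl X A \<subseteq> h_cl X B"
  unfolding h_cl_def by blast

lemma h_cl_minimal: "h_closed X F \<Longrightarrow> A \<subseteq> F \<Longrightarrow> h_cl X A \<subseteq> F"
  unfolding h_cl_def by blast

lemma h_cl_subset_Un_interior_closure:
  assumes "A \<subseteq> topspace X"
  shows "h_cl X A \<subseteq> A \<union> X interior_of (X closure_of A)"
  by (simp add: assms h_cl_minimal semi_closed_Un_interior_closure semi_closed_imp_h_closed)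

text \<open>An \<open>h\<close>-closed \<open>F\<close> containing \<open>A\<close> but not
  \<open>y\<close> would lie in the \<open>w\<close>-open complement of \<open>{y}\<close>, and so
  would \<open>s_cl X F\<close>. But \<open>s_cl X F\<close> contains the interior of the closure of
  \<open>A\<close>.\<close>

lemma w_closed_singleton_in_h_cl:
  assumes w: "w_closed X {y}" and y: "y \<in> X interior_of (X closure_of A)"
  shows "y \<in> h_cl X A"
  unfolding h_cl_def
proof (clarsimp, rule ccontr)
  fix F assume F: "h_closed X F" "A \<subseteq> F" and "y \<notin> F"
  have "{y} \<subseteq> topspace X"
    using w by (simp add: w_closed_def)
  then have "topspace X - (topspace X - {y}) = {y}"
    by blast
  then have "w_open X (topspace X - {y})"
    using w by (simp add: w_open_def)
  moreover have "F \<subseteq> topspace X - {y}"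
    using F \<open>y \<notin> F\<close> by (auto simp: h_closed_def)
  ultimately have "s_cl X F \<subseteq> topspace X - {y}"
    using F by (simp add: h_closed_def)
  moreover have "y \<in> s_cl X F"
    using y interior_closure_subset_s_cl[of X F]
      interior_of_mono[OF closure_of_mono[OF \<open>A \<subseteq> F\<close>, of X], of X] by blast
  ultimately show False
    by blast
qed

text \<open>A \<open>w\<close>-open superset other than the carrier would be the complement of
  \<open>{y}\<close> itself, making \<open>{y}\<close> \<open>w\<close>-closed. The point
  \<open>p\<close> prevents this: its complement is semi-open and contains \<open>y\<close> but not
  the closure of \<open>{y}\<close>.\<close>

lemma h_closed_delete_point:
  assumes y: "y \<in> topspace X" and p: "p \<in> X closure_of {y}" "p \<noteq> y" "semi_closed X {p}"
  shows "h_closed X (topspace X - {y})"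
  unfolding h_closed_def
proof (intro conjI allI impI)
  fix U assume U: "w_open X U \<and> topspace X - {y} \<subseteq> U"
  have "y \<in> U"
  proof (rule ccontr)
    assume "y \<notin> U"
    with U have "topspace X - U = {y}"
      using y by (auto simp: w_open_def)
    with U have "w_closed X {y}"
      by (simp add: w_open_def)
    moreover have "semi_open X (topspace X - {p})"
      using p by (simp add: semi_open_def semi_closed_def double_diff)
    ultimately have "X closure_of {y} \<subseteq> topspace X - {p}"
      using y p by (simp add: w_closed_def)
    with p show False
      by blast
  qed
  with U have "U = topspace X"
    by (auto simp: w_open_def)
  moreover have "semi_closed X (topspace X)"
    by (simp add: closedin_imp_semi_closed)
  ultimately show "s_cl X (topspace X - {y}) \<subseteq> U"
    unfolding s_cl_def by blast
qed blast

section \<open>Points whose closure is clopen and indiscrete\<close>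

lemma C_set_delete_point:
  assumes "openin X (X closure_of {z})"
  shows "C_set X (topspace X - {z})"
proof -
  \<comment> \<open>This interior is clopen, so taking closure and interior again returns it. The
    open factor of the \<open>C\<close>-set is the carrier.\<close>
  have "X interior_of (topspace X - {z}) = topspace X - X closure_of {z}"
    by (simp add: interior_of_complement)
  moreover have "openin X (topspace X - X closure_of {z})" "closedin X (topspace X - X closure_of {z})"
    using assms by (auto simp: openin_diff closedin_diff)
  ultimately have "alpha_star_set X (topspace X - {z})"
    by (simp add: alpha_star_set_def closure_of_closedin interior_of_openin)
  moreover have "topspace X - {z} = topspace X \<inter> (topspace X - {z})"
    by blast
  ultimately show ?thesis
    unfolding C_set_def by blast
qed

lemma clopen_indiscrete_closure_of_singleton:
  assumes y: "y \<in> topspace X" and "\<not> closedin X {y}"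
    and no_nd: "\<And>p. p \<in> X closure_of {y} \<Longrightarrow> p \<noteq> y \<Longrightarrow> \<not> semi_closed X {p}"
  shows "openin X (X closure_of {y})"
    and "\<And>z. z \<in> X closure_of {y} \<Longrightarrow> X closure_of {z} = X closure_of {y}"
    and "\<And>z. z \<in> X closure_of {y} \<Longrightarrow> z \<in> X interior_of (X closure_of {z})"
proof -
  let ?K = "X closure_of {y}"
  have Ksub: "?K \<subseteq> topspace X"
    by (rule closure_of_subset_topspace)
  have yK: "y \<in> ?K"
    using y by (simp add: in_closure_of)
  have cl_sub: "X closure_of {p} \<subseteq> ?K" if "p \<in> ?K" for p
    using that by (simp add: closure_of_minimal)
  \<comment> \<open>Applied below to the interior of the closure of \<open>{p}\<close>, this puts
    \<open>y\<close> into the closure of every \<open>p\<close> in \<open>?K\<close>.\<close>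
  have y_nbhd: "y \<in> W" if "openin X W" "p \<in> W" "p \<in> ?K" for W p
    using that by (auto simp: in_closure_of)
  have dense: "p \<in> X interior_of (X closure_of {p})" if "p \<in> ?K" "p \<noteq> y" for p
    using semi_closed_singleton_or_interior_closure[of p X] no_nd[OF that] subsetD[OF Ksub that(1)] by simp
  have y_int: "y \<in> X interior_of (X closure_of {p})" if "p \<in> ?K" "p \<noteq> y" for p
    using y_nbhd[OF openin_interior_of dense[OF that] \<open>p \<in> ?K\<close>] .
  \<comment> \<open>The hypothesis on semi-closed points says nothing about \<open>y\<close> itself;
    a second point of \<open>?K\<close> is what places \<open>y\<close> in the interior of
    \<open>?K\<close>.\<close>
  obtain z where z: "z \<in> ?K" "z \<noteq> y"
  proof -
    have "?K \<noteq> {y}"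
      using assms(2) by (metis closedin_closure_of)
    then show thesis
      using yK that by blast
  qed
  have y_dense: "y \<in> X interior_of ?K"
    using y_int[OF z] interior_of_mono[OF cl_sub[OF z(1)]] by blast
  show all: "p \<in> X interior_of (X closure_of {p})" if "p \<in> ?K" for p
    using dense that y_dense by (cases "p = y") auto
  show "X closure_of {p} = ?K" if "p \<in> ?K" for p
  proof (rule antisym)
    have "y \<in> X closure_of {p}"
      using y_int[of p] that yK interior_of_subset by (cases "p = y") fastforce+
    then show "?K \<subseteq> X closure_of {p}"
      by (simp add: closure_of_minimal)
  qed (rule cl_sub[OF that])
  have "?K \<subseteq> X interior_of ?K"
    using all interior_of_mono[OF cl_sub] by blast
  then show "openin X ?K"
    by (metis interior_of_subset openin_interior_of subset_antisym)
qed

text \<open>If a semi-open set contains \<open>z\<close> but omits \<open>p\<close> in the closure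
  of \<open>{z}\<close>, its semi-closed complement contains the interior of the closure of
  \<open>{p}\<close>, hence \<open>z\<close>.\<close>

lemma w_closed_singleton_indiscrete:
  assumes z: "z \<in> topspace X"
    and dense: "\<And>p. p \<in> X closure_of {z} \<Longrightarrow> z \<in> X interior_of (X closure_of {p})"
  shows "w_closed X {z}"
  unfolding w_closed_def
proof (intro conjI allI impI subsetI)
  fix S p assume S: "semi_open X S \<and> {z} \<subseteq> S" and p: "p \<in> X closure_of {z}"
  show "p \<in> S"
  proof (rule ccontr)
    assume "p \<notin> S"
    then have "{p} \<subseteq> topspace X - S"
      using p by (auto simp: in_closure_of)
    then have "X interior_of (X closure_of {p}) \<subseteq> topspace X - S"
      using S interior_closure_subset_semi_closed unfolding semi_open_def by metis
    with dense[OF p] S show False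
      by blast
  qed
qed (use z in auto)

section \<open>The closed-point criterion for \<open>H*\<close>-closed sets\<close>

lemma Hstar_closedD:
  assumes A: "Hstar_closed X A" and y: "closedin X {y}" "y \<in> X interior_of (X closure_of A)"
  shows "y \<in> A"
proof (rule ccontr)
  assume "y \<notin> A"
  have "h_cl X {y} \<subseteq> {y}"
    by (simp add: h_cl_minimal closedin_imp_semi_closed semi_closed_imp_h_closed y)
  then have "hCg_closed X {y}"
    using closedin_subset[OF y(1)] by (auto simp: hCg_closed_def)
  \<comment> \<open>This \<open>hCg\<close>-open superset of \<open>A\<close> keeps \<open>y\<close>
    out of \<open>h_cl X A\<close>, whereas \<open>y\<close> must belong to it because a closed
    singleton is \<open>w\<close>-closed.\<close>
  then have "hCg_open X (topspace X - {y})"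
    by (simp add: hCg_open_def hCg_closed_def double_diff)
  then have "h_cl X A \<subseteq> topspace X - {y}"
    using A \<open>y \<notin> A\<close> by (auto simp: Hstar_closed_def)
  moreover have "w_closed X {y}"
    using y closedin_subset[OF y(1)] by (simp add: w_closed_def closure_of_closedin)
  ultimately show False
    using w_closed_singleton_in_h_cl y(2) by fastforce
qed

lemma Hstar_closedI:
  assumes A: "A \<subseteq> topspace X"
    and closed_points: "\<And>y. closedin X {y} \<Longrightarrow> y \<in> X interior_of (X closure_of A) \<Longrightarrow> y \<in> A"
  shows "Hstar_closed X A"
  unfolding Hstar_closed_def
proof (intro conjI allI impI subsetI)
  fix U y assume U: "hCg_open X U \<and> A \<subseteq> U" and y: "y \<in> h_cl X A"
  show "y \<in> U"
  proof (rule ccontr)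
    assume "y \<notin> U"
    let ?K = "X closure_of {y}" and ?B = "topspace X - U"
    have "y \<notin> A"
      using U \<open>y \<notin> U\<close> by blast
    then have yA: "y \<in> X interior_of (X closure_of A)"
      using y h_cl_subset_Un_interior_closure[OF A] by blast
    then have yX: "y \<in> topspace X"
      using interior_of_subset_topspace by fastforce
    have "\<not> closedin X {y}"
      using \<open>y \<notin> A\<close> closed_points yA by blast
    \<comment> \<open>Otherwise deleting \<open>y\<close> from the carrier leaves an
      \<open>h\<close>-closed superset of \<open>A\<close>, so \<open>y\<close> is not in
      \<open>h_cl X A\<close>.\<close>
    moreover have "\<not> semi_closed X {p}" if "p \<in> ?K" "p \<noteq> y" for p
    proof
      assume "semi_closed X {p}"
      then have "h_cl X A \<subseteq> topspace X - {y}"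
        using h_closed_delete_point[OF yX that] A \<open>y \<notin> A\<close> by (intro h_cl_minimal) auto
      with y show False
        by blast
    qed
    ultimately have K_open: "openin X ?K"
      and K_eq: "\<And>z. z \<in> ?K \<Longrightarrow> X closure_of {z} = ?K"
      and K_dense: "\<And>z. z \<in> ?K \<Longrightarrow> z \<in> X interior_of (X closure_of {z})"
      using clopen_indiscrete_closure_of_singleton[OF yX] by blast+
    have "y \<in> ?K"
      using yX by (simp add: in_closure_of)
    moreover have "y \<in> X closure_of A"
      using yA interior_of_subset by fastforce
    \<comment> \<open>\<open>?K\<close> is an open neighbourhood of \<open>y\<close>, which lies in
      the closure of \<open>A\<close>.\<close>
    ultimately obtain z where z: "z \<in> A" "z \<in> ?K"
      using K_open unfolding in_closure_of[of y X A] by blast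
    have "w_closed X {z}"
      using z A K_eq K_dense by (intro w_closed_singleton_indiscrete) auto
    moreover have "z \<in> X interior_of ?K"
      using K_eq K_dense z by force
    ultimately have "z \<in> h_cl X {y}"
      by (rule w_closed_singleton_in_h_cl)
    moreover have "h_cl X {y} \<subseteq> h_cl X ?B"
      using \<open>y \<notin> U\<close> yX by (intro h_cl_mono) auto
    \<comment> \<open>As \<open>z\<close> lies in \<open>A\<close> and so in \<open>U\<close>, this
      \<open>C\<close>-set contains \<open>?B\<close>. Hence the \<open>hCg\<close>-closed
      \<open>?B\<close> has \<open>z\<close> outside its \<open>h\<close>-closure, although
      \<open>y\<close> in \<open>?B\<close> forces \<open>z\<close> into it.\<close>
    moreover have "C_set X (topspace X - {z})"
      using C_set_delete_point K_open K_eq z by metis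
    then have "h_cl X ?B \<subseteq> topspace X - {z}"
      using U z unfolding hCg_open_def hCg_closed_def by blast
    ultimately show False
      by blast
  qed
qed (use A in auto)

section \<open>Stability of \<open>H*\<close>-closed sets under intersection\<close>

lemma Hstar_closed_topspace: "Hstar_closed X (topspace X)"
  by (rule Hstar_closedI) (use closedin_subset in auto)

text \<open>The closed-point criterion passes to intersections because interior and closure are
  monotone. The empty family is excluded since its intersection is the whole type.\<close>

lemma Hstar_closed_Inter:
  assumes "\<F> \<noteq> {}" "\<And>F. F \<in> \<F> \<Longrightarrow> Hstar_closed X F"
  shows "Hstar_closed X (\<Inter>\<F>)"
proof (rule Hstar_closedI)
  show "\<Inter>\<F> \<subseteq> topspace X"
    using assms unfolding Hstar_closed_def by blast
next
  fix y assume y: "closedin X {y}" "y \<in> X interior_of (X closure_of \<Inter>\<F>)"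
  show "y \<in> \<Inter>\<F>"
  proof
    fix F assume "F \<in> \<F>"
    then have "y \<in> X interior_of (X closure_of F)"
      using y interior_of_mono closure_of_mono by (metis Inter_lower subsetD)
    then show "y \<in> F"
      using Hstar_closedD assms(2) \<open>F \<in> \<F>\<close> y(1) by metis
  qed
qed

lemma Hstar_closed_Hstar_cl:
  assumes "A \<subseteq> topspace X"
  shows "Hstar_closed X (Hstar_cl X A)"
  unfolding Hstar_cl_def using assms Hstar_closed_topspace by (intro Hstar_closed_Inter) auto

lemma Hstar_open_complement:
  "Hstar_closed X A \<Longrightarrow> Hstar_open X (topspace X - A)"
  by (simp add: Hstar_open_def Hstar_closed_def double_diff)

section \<open>Equivalent forms of \<open>H*\<close>-normality\<close>

lemma Hstar_normal_iff_closed_cover: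
  "Hstar_normal X \<longleftrightarrow>
     (\<forall>Q R. openin X Q \<and> openin X R \<and> Q \<union> R = topspace X \<longrightarrow>
        (\<exists>D E. Hstar_closed X D \<and> Hstar_closed X E \<and> D \<subseteq> Q \<and> E \<subseteq> R \<and> D \<union> E = topspace X))"
  (is "_ \<longleftrightarrow> ?cover")
proof
  assume N: "Hstar_normal X"
  show ?cover
  proof (intro allI impI)
    fix Q R assume QR: "openin X Q \<and> openin X R \<and> Q \<union> R = topspace X"
    then have "closedin X (topspace X - Q)" "closedin X (topspace X - R)"
      "disjnt (topspace X - Q) (topspace X - R)"
      by (auto simp: disjnt_def)
    then obtain U V where UV: "Hstar_open X U" "Hstar_open X V" "disjnt U V"
      "topspace X - Q \<subseteq> U" "topspace X - R \<subseteq> V"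
      using N unfolding Hstar_normal_def by meson
    show "\<exists>D E. Hstar_closed X D \<and> Hstar_closed X E \<and> D \<subseteq> Q \<and> E \<subseteq> R \<and> D \<union> E = topspace X"
      using UV QR
      \<comment> \<open>Complementation turns disjoint sets into sets covering the carrier; the
        converse direction uses the same duality.\<close>
      by (intro exI[of _ "topspace X - U"] exI[of _ "topspace X - V"])
        (auto simp: Hstar_open_def disjnt_def)
  qed
next
  assume cover: ?cover
  show "Hstar_normal X"
    unfolding Hstar_normal_def
  proof (intro allI impI)
    fix A B assume AB: "closedin X A \<and> closedin X B \<and> disjnt A B"
    then have sub: "A \<subseteq> topspace X" "B \<subseteq> topspace X"
      by (simp_all add: closedin_subset)
    from AB have "openin X (topspace X - A) \<and> openin X (topspace X - B) \<and>
        (topspace X - A) \<union> (topspace X - B) = topspace X"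
      by (auto simp: disjnt_def)
    then obtain D E where DE: "Hstar_closed X D" "Hstar_closed X E"
      "D \<subseteq> topspace X - A" "E \<subseteq> topspace X - B" "D \<union> E = topspace X"
      using cover by meson
    show "\<exists>U V. Hstar_open X U \<and> Hstar_open X V \<and> disjnt U V \<and> A \<subseteq> U \<and> B \<subseteq> V"
      using DE sub Hstar_open_complement
      by (intro exI[of _ "topspace X - D"] exI[of _ "topspace X - E"]) (auto simp: disjnt_def)
  qed
qed

lemma Hstar_normal_iff_shrinking:
  "Hstar_normal X \<longleftrightarrow>
     (\<forall>J K. closedin X J \<and> openin X K \<and> J \<subseteq> K \<longrightarrow>
        (\<exists>Q. Hstar_open X Q \<and> J \<subseteq> Q \<and> Q \<subseteq> Hstar_cl X Q \<and> Hstar_cl X Q \<subseteq> K))"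
  (is "_ \<longleftrightarrow> ?shrink")
proof
  assume N: "Hstar_normal X"
  show ?shrink
  proof (intro allI impI)
    fix J K assume JK: "closedin X J \<and> openin X K \<and> J \<subseteq> K"
    then have "closedin X (topspace X - K)" "disjnt J (topspace X - K)"
      by (auto simp: disjnt_def)
    then obtain U V where UV: "Hstar_open X U" "Hstar_open X V" "disjnt U V"
      "J \<subseteq> U" "topspace X - K \<subseteq> V"
      using N JK unfolding Hstar_normal_def by meson
    \<comment> \<open>The complement of \<open>V\<close> separates \<open>U\<close> from the
      complement of \<open>K\<close>, so it bounds the \<open>H*\<close>-closure of \<open>U\<close>
      inside \<open>K\<close>.\<close>
    have "Hstar_closed X (topspace X - V)" "U \<subseteq> topspace X - V"
      using UV by (auto simp: Hstar_open_def disjnt_def)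
    then have "Hstar_cl X U \<subseteq> topspace X - V"
      unfolding Hstar_cl_def by blast
    moreover have "U \<subseteq> Hstar_cl X U"
      unfolding Hstar_cl_def by blast
    ultimately show "\<exists>Q. Hstar_open X Q \<and> J \<subseteq> Q \<and> Q \<subseteq> Hstar_cl X Q \<and> Hstar_cl X Q \<subseteq> K"
      using UV by blast
  qed
next
  assume shrink: ?shrink
  show "Hstar_normal X"
    unfolding Hstar_normal_def
  proof (intro allI impI)
    fix A B assume AB: "closedin X A \<and> closedin X B \<and> disjnt A B"
    then have sub: "A \<subseteq> topspace X" "B \<subseteq> topspace X"
      by (simp_all add: closedin_subset)
    have "closedin X A \<and> openin X (topspace X - B) \<and> A \<subseteq> topspace X - B"
      using AB sub by (auto simp: disjnt_def)
    then obtain Q where Q: "Hstar_open X Q" "A \<subseteq> Q" "Q \<subseteq> Hstar_cl X Q"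
      "Hstar_cl X Q \<subseteq> topspace X - B"
      using shrink by meson
    \<comment> \<open>Stability under intersection makes \<open>Hstar_cl X Q\<close> itself
      \<open>H*\<close>-closed, so its complement can serve as the set around
      \<open>B\<close>.\<close>
    have "Hstar_open X (topspace X - Hstar_cl X Q)"
      using Q(1) unfolding Hstar_open_def[of X Q] by (intro Hstar_open_complement Hstar_closed_Hstar_cl) simp
    moreover have "disjnt Q (topspace X - Hstar_cl X Q)" "B \<subseteq> topspace X - Hstar_cl X Q"
      using Q sub by (auto simp: disjnt_def)
    ultimately show "\<exists>U V. Hstar_open X U \<and> Hstar_open X V \<and> disjnt U V \<and> A \<subseteq> U \<and> B \<subseteq> V"
      using Q by blast
  qed
qed

theorem theorem1p11:
  fixes X :: "'a topology"
  shows "(Hstar_normal X \<longleftrightarrow>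
           (\<forall>Q R. openin X Q \<and> openin X R \<and> Q \<union> R = topspace X \<longrightarrow>
              (\<exists>D E. Hstar_closed X D \<and> Hstar_closed X E \<and> D \<subseteq> Q \<and> E \<subseteq> R \<and>
                     D \<union> E = topspace X)))
       \<and> (Hstar_normal X \<longleftrightarrow>
           (\<forall>J K. closedin X J \<and> openin X K \<and> J \<subseteq> K \<longrightarrow>
              (\<exists>Q. Hstar_open X Q \<and> J \<subseteq> Q \<and> Q \<subseteq> Hstar_cl X Q \<and> Hstar_cl X Q \<subseteq> K)))"
  using Hstar_normal_iff_closed_cover Hstar_normal_iff_shrinking by (rule conjI)

end
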